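(* For every infinite cardinal $\kappa$ there is a Tychonoff submaximal (hence irresolvable) space $X$ such that $|X|=\Delta(X)=\kappa$ and $X$ has disjoint tightness.
   Context: A space is submaximal if all its dense subsets are open. The dispersion character is $\Delta(X)=\min\{|U| : U \text{ is nonempty open in } X\}$. A space $X$ is irresolvable if $\Delta(X)\ge 2$ and $X$ does not contain two disjoint dense subsets. $A'$ denotes the set of accumulation points of $A$ ($x\in A'$ iff every neighborhood of $x$ contains a point of $A\setminus\{x\}$). A space $X$ has disjoint tightness if whenever $A\subseteq X$ and $x\in A'$ there are $A_1,A_2\subseteq A$ such that $A_1\cap A_2=\emptyset$ and $x\in A_1'\cap A_2'$. *)

theory Defs
  imports "HOL-Analysis.Analysis"
begin

unbundle cardinal_syntax

definition tychonoff_space :: "'a topology \<Rightarrow> bool" where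
  "tychonoff_space X \<longleftrightarrow> completely_regular_space X \<and> t1_space X"

definition dense_in :: "'a topology \<Rightarrow> 'a set \<Rightarrow> bool" where
  "dense_in X D \<longleftrightarrow> D \<subseteq> topspace X \<and> X closure_of D = topspace X"

definition submaximal_space :: "'a topology \<Rightarrow> bool" where
  "submaximal_space X \<longleftrightarrow> (\<forall>D. dense_in X D \<longrightarrow> openin X D)"

text \<open>The minimum is taken among cardinals, i.e.\ well-orders compared by \<open>\<le>o\<close>. The value is
  determined up to \<open>=o\<close>, and it is meaningful for nonempty spaces only.\<close>

definition dispersion_character :: "'a topology \<Rightarrow> 'a rel" where
  "dispersion_character X =
     |SOME U. openin X U \<and> U \<noteq> {} \<and> (\<forall>V. openin X V \<and> V \<noteq> {} \<longrightarrow> |U| \<le>o |V| )|"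

lemma dispersion_character_attained:
  assumes "topspace X \<noteq> {}"
  shows "\<exists>U. openin X U \<and> U \<noteq> {} \<and> dispersion_character X = |U| \<and>
           (\<forall>V. openin X V \<and> V \<noteq> {} \<longrightarrow> |U| \<le>o |V| )"
proof -
  let ?R = "card_of ` {U. openin X U \<and> U \<noteq> {}}"
  have "?R \<noteq> {}" using assms by auto
  moreover have "\<forall>r\<in>?R. Card_order r" using card_of_Card_order by blast
  ultimately obtain r where "r \<in> ?R" "\<forall>r'\<in>?R. r \<le>o r'"
    using exists_minim_Card_order[of ?R] by blast
  then have "\<exists>U. openin X U \<and> U \<noteq> {} \<and> (\<forall>V. openin X V \<and> V \<noteq> {} \<longrightarrow> |U| \<le>o |V| )"
    by blast
  from someI_ex[OF this] show ?thesis
    unfolding dispersion_character_def by blast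
qed

definition irresolvable_space :: "'a topology \<Rightarrow> bool" where
  "irresolvable_space X \<longleftrightarrow>
     BNF_Cardinal_Arithmetic.ctwo \<le>o dispersion_character X \<and>
     \<not> (\<exists>D E. dense_in X D \<and> dense_in X E \<and> D \<inter> E = {})"

definition disjoint_tightness :: "'a topology \<Rightarrow> bool" where
  "disjoint_tightness X \<longleftrightarrow>
     (\<forall>A x. A \<subseteq> topspace X \<and> x \<in> X derived_set_of A \<longrightarrow>
        (\<exists>A1 A2. A1 \<subseteq> A \<and> A2 \<subseteq> A \<and> A1 \<inter> A2 = {} \<and>
           x \<in> X derived_set_of A1 \<inter> X derived_set_of A2))"

end

theory Submission
  imports Defs "HOL-Algebra.Free_Abelian_Groups"
begin

no_notation Set_Algebras.elt_set_eq (infix "=o" 50)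

text \<open>
  Start from an independent family \<open>f\<close> of two-valued functions on \<open>X\<close>, indexed by the pairs
  \<open>(A, x)\<close> with \<open>A \<subseteq> X\<close> and \<open>x \<in> X\<close>, all of whose finite cylinders have size \<open>|X|\<close>. For a
  family \<open>\<A>\<close> of subsets, change \<open>f (A, x)\<close> for \<open>A \<in> \<A>\<close> to vanish on \<open>A\<close> and not at \<open>x\<close>. Independence
  has finite character, so Zorn's lemma gives a maximal \<open>\<A>\<close> for which the changed family is still
  independent; give \<open>X\<close> the topology that it generates. Members of \<open>\<A>\<close> are closed, whereas a set
  outside \<open>\<A>\<close> contains a cylinder up to fewer than \<open>|X|\<close> points. Sets with fewer than \<open>|X|\<close> points
  are therefore closed, and so is every set with empty interior.

  By submaximality, disjoint tightness need only be checked for an open set \<open>U\<close> and a point \<open>x\<close> of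
  its boundary. As \<open>U\<close> is a union of at most \<open>|X|\<close> cylinders and there are more coordinates than
  that, infinitely many coordinates \<open>g 0, g 1, \<dots>\<close> are irrelevant to \<open>U\<close>. Split \<open>U\<close> by the parity of
  the first \<open>n\<close> at which a point differs from \<open>x\<close> in the coordinate \<open>g n\<close>.
\<close>

section \<open>Topologies generated by independent families\<close>

definition cylinder :: "'a set \<Rightarrow> ('i \<Rightarrow> 'a \<Rightarrow> bool) \<Rightarrow> 'i set \<Rightarrow> ('i \<Rightarrow> bool) \<Rightarrow> 'a set" where
  "cylinder X h J e = {y \<in> X. \<forall>i\<in>J. h i y = e i}"

text \<open>Cylinders must have full size, not merely be nonempty: this yields the dispersion
  character and keeps them nonempty when fewer than |X| points are deleted.\<close>

definition independent_family :: "'a set \<Rightarrow> 'i set \<Rightarrow> ('i \<Rightarrow> 'a \<Rightarrow> bool) \<Rightarrow> bool" where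
  "independent_family X I h \<longleftrightarrow>
     (\<forall>J e. finite J \<and> J \<subseteq> I \<longrightarrow> |X| \<le>o |cylinder X h J e| )"

text \<open>The initial topology of the maps \<open>h i\<close> with \<open>i\<close> in
  \<open>I\<close> into the discrete two-point space.\<close>

definition cylinder_topology :: "'a set \<Rightarrow> 'i set \<Rightarrow> ('i \<Rightarrow> 'a \<Rightarrow> bool) \<Rightarrow> 'a topology" where
  "cylinder_topology X I h = topology (\<lambda>U. U \<subseteq> X \<and>
     (\<forall>y\<in>U. \<exists>J. finite J \<and> J \<subseteq> I \<and> cylinder X h J (\<lambda>i. h i y) \<subseteq> U))"

lemma openin_cylinder_topology:
  "openin (cylinder_topology X I h) U \<longleftrightarrow> U \<subseteq> X \<and>
     (\<forall>y\<in>U. \<exists>J. finite J \<and> J \<subseteq> I \<and> cylinder X h J (\<lambda>i. h i y) \<subseteq> U)"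
proof -
  let ?P = "\<lambda>U. U \<subseteq> X \<and>
     (\<forall>y\<in>U. \<exists>J. finite J \<and> J \<subseteq> I \<and> cylinder X h J (\<lambda>i. h i y) \<subseteq> U)"
  have "istopology ?P"
    unfolding istopology_def
  proof (intro conjI allI impI)
    fix S T assume S: "?P S" and T: "?P T"
    show "S \<inter> T \<subseteq> X" using S by blast
    show "\<forall>y\<in>S \<inter> T. \<exists>J. finite J \<and> J \<subseteq> I \<and> cylinder X h J (\<lambda>i. h i y) \<subseteq> S \<inter> T"
    proof
      fix y assume "y \<in> S \<inter> T"
      then obtain J K where "finite J" "J \<subseteq> I" "cylinder X h J (\<lambda>i. h i y) \<subseteq> S"
        "finite K" "K \<subseteq> I" "cylinder X h K (\<lambda>i. h i y) \<subseteq> T" using S T by blast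
      then show "\<exists>J. finite J \<and> J \<subseteq> I \<and> cylinder X h J (\<lambda>i. h i y) \<subseteq> S \<inter> T"
        by (intro exI[of _ "J \<union> K"]) (auto simp: cylinder_def)
    qed
  next
    fix \<K> assume K: "\<forall>K\<in>\<K>. ?P K"
    show "\<Union>\<K> \<subseteq> X" using K by blast
    show "\<forall>y\<in>\<Union>\<K>. \<exists>J. finite J \<and> J \<subseteq> I \<and> cylinder X h J (\<lambda>i. h i y) \<subseteq> \<Union>\<K>"
      using K by (meson UnionE Union_upper subset_trans)
  qed
  then show ?thesis
    unfolding cylinder_topology_def by (simp add: topology_inverse')
qed

lemma topspace_cylinder_topology [simp]: "topspace (cylinder_topology X I h) = X"
proof -
  have "openin (cylinder_topology X I h) X"
    unfolding openin_cylinder_topology by (auto simp: cylinder_def intro: exI[of _ "{}"])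
  then show ?thesis
    by (meson openin_cylinder_topology openin_subset openin_topspace subset_antisym)
qed

lemma openin_cylinder:
  assumes "finite J" "J \<subseteq> I"
  shows "openin (cylinder_topology X I h) (cylinder X h J e)"
  unfolding openin_cylinder_topology
  using assms by (auto simp: cylinder_def intro!: exI[of _ J])

lemma closedin_cylinder:
  assumes "finite J" "J \<subseteq> I"
  shows "closedin (cylinder_topology X I h) (cylinder X h J e)"
  unfolding closedin_def openin_cylinder_topology topspace_cylinder_topology
  using assms by (fastforce simp: cylinder_def intro!: exI[of _ J])

text \<open>Cylinders are clopen, so the indicator of the complement of a cylinder is a continuous
  separating function.\<close>

lemma completely_regular_cylinder_topology:
  "completely_regular_space (cylinder_topology X I h)"
  unfolding completely_regular_space_def
proof (intro allI impI, elim conjE)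
  let ?T = "cylinder_topology X I h"
  fix S x assume S: "closedin ?T S" and x: "x \<in> topspace ?T - S"
  have "openin ?T (X - S)"
    using S by (metis closedin_def topspace_cylinder_topology)
  then obtain J where J: "finite J" "J \<subseteq> I" "cylinder X h J (\<lambda>i. h i x) \<subseteq> X - S"
    using x unfolding openin_cylinder_topology topspace_cylinder_topology by meson
  define C where "C = cylinder X h J (\<lambda>i. h i x)"
  have C: "openin ?T C" "openin ?T (X - C)" "C \<subseteq> X"
    using openin_cylinder[OF J(1,2)] closedin_cylinder[OF J(1,2)]
    by (auto simp: C_def closedin_def cylinder_def)
  let ?f = "\<lambda>y. if y \<in> C then 0 else 1 :: real"
  have "openin ?T {y \<in> X. ?f y \<in> U}" for U
  proof -
    have "{y \<in> X. ?f y \<in> U} = (if 0 \<in> U then C else {}) \<union> (if 1 \<in> U then X - C else {})"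
      using C(3) by auto
    moreover have "openin ?T (if 0 \<in> U then C else {})" "openin ?T (if 1 \<in> U then X - C else {})"
      using C(1,2) by simp_all
    ultimately show ?thesis by (simp only: openin_Un)
  qed
  then have "continuous_map ?T (top_of_set {0..1}) ?f"
    by (auto simp: continuous_map_def)
  moreover have "?f x = 0" "?f ` S \<subseteq> {1}"
    using J(3) x by (auto simp: C_def cylinder_def)
  ultimately show "\<exists>f. continuous_map ?T (top_of_set {0..1}) f \<and> f x = (0::real) \<and> f ` S \<subseteq> {1}"
    by blast
qed

lemma card_of_openin_cylinder_topology:
  assumes "independent_family X I h" "openin (cylinder_topology X I h) U" "U \<noteq> {}"
  shows "|X| \<le>o |U|"
proof -
  obtain y where "y \<in> U" using assms(3) by blast
  then obtain J where "finite J" "J \<subseteq> I" "cylinder X h J (\<lambda>i. h i y) \<subseteq> U"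
    using assms(2) unfolding openin_cylinder_topology by blast
  then show ?thesis
    using assms(1) card_of_mono1 ordLeq_transitive unfolding independent_family_def by meson
qed

lemma dispersion_character_cylinder_topology:
  assumes "independent_family X I h" "X \<noteq> {}"
  shows "dispersion_character (cylinder_topology X I h) =o |X|"
proof -
  obtain U where U: "openin (cylinder_topology X I h) U" "U \<noteq> {}"
    "dispersion_character (cylinder_topology X I h) = |U|"
    using dispersion_character_attained[of "cylinder_topology X I h"] assms(2) by auto
  have "|U| \<le>o |X|"
    using openin_subset[OF U(1)] by (simp add: card_of_mono1)
  then show ?thesis
    using card_of_openin_cylinder_topology[OF assms(1) U(1,2)] U(3) by (simp add: ordIso_iff_ordLeq)
qed

text \<open>Independence yields a single point that copies some \<open>y\<close> in \<open>U\<close>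
  on a finite support of \<open>y\<close>, copies \<open>x\<close> on the other coordinates of a
  given neighbourhood, and first differs from \<open>x\<close> along \<open>g\<close> at a
  prescribed place.\<close>

lemma cylinder_topology_split_open:
  fixes h :: "'i \<Rightarrow> 'a \<Rightarrow> bool"
  assumes ind: "independent_family X I h" and inf: "infinite X" and large: "|X| <o |I|"
    and U: "openin (cylinder_topology X I h) U"
    and x: "x \<in> cylinder_topology X I h closure_of U" "x \<notin> U"
  shows "\<exists>A1 A2. A1 \<subseteq> U \<and> A2 \<subseteq> U \<and> A1 \<inter> A2 = {} \<and>
           x \<in> cylinder_topology X I h derived_set_of A1 \<inter>
               cylinder_topology X I h derived_set_of A2"
proof -
  let ?T = "cylinder_topology X I h"
  obtain J where J: "\<And>y. y \<in> U \<Longrightarrow>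
      finite (J y) \<and> J y \<subseteq> I \<and> cylinder X h (J y) (\<lambda>i. h i y) \<subseteq> U"
    using U unfolding openin_cylinder_topology by metis
  define K where "K = (\<Union>y\<in>U. J y)"
  have UX: "U \<subseteq> X" and xX: "x \<in> X"
    using openin_subset[OF U] x(1) by (auto simp: in_closure_of)
  have K: "|K| \<le>o |X|"
    unfolding K_def
    by (rule card_of_UNION_ordLeq_infinite)
      (use inf UX J in \<open>auto simp: card_of_mono1 intro!: ordLess_imp_ordLeq[OF finite_ordLess_infinite2]\<close>)
  have "infinite (I - K)"
  proof
    assume "finite (I - K)"
    then have "|I - K| \<le>o |X|"
      using inf by (simp add: finite_ordLess_infinite2 ordLess_imp_ordLeq)
    then have "|K \<union> (I - K)| \<le>o |X|"
      using K inf by (intro card_of_Un_ordLeq_infinite_Field) (simp_all add: Field_card_of)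
    moreover have "|I| \<le>o |K \<union> (I - K)|"
      by (simp add: card_of_mono1)
    ultimately show False
      using large not_ordLess_ordLeq ordLeq_transitive by blast
  qed
  then obtain g :: "nat \<Rightarrow> 'i" where g: "inj g" "range g \<subseteq> I - K"
    using infinite_countable_subset by blast
  \<comment> \<open>Where \<open>y\<close> agrees with \<open>x\<close> at every \<open>g n\<close>,
    the value \<open>k y\<close> is arbitrary; this cannot spoil disjointness.\<close>
  define k where "k y = (LEAST n. h (g n) y \<noteq> h (g n) x)" for y
  define A where "A b = {y \<in> U. even (k y) = b}" for b
  have "x \<in> ?T derived_set_of (A b)" for b
    unfolding in_derived_set_of topspace_cylinder_topology
  proof (intro conjI allI impI)
    show "x \<in> X" by (rule xX)
    fix V assume V: "x \<in> V \<and> openin ?T V"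
    then obtain L where L: "finite L" "L \<subseteq> I" "cylinder X h L (\<lambda>i. h i x) \<subseteq> V"
      unfolding openin_cylinder_topology by blast
    \<comment> \<open>As \<open>J y\<close> will lie in \<open>K\<close>, agreement of
      \<open>y\<close> with \<open>x\<close> on \<open>L \<inter> K\<close> makes copying
      \<open>y\<close> on \<open>J y\<close> compatible with copying \<open>x\<close> on
      \<open>L\<close>.\<close>
    have "openin ?T (cylinder X h (L \<inter> K) (\<lambda>i. h i x))" "x \<in> cylinder X h (L \<inter> K) (\<lambda>i. h i x)"
      using L xX by (auto intro!: openin_cylinder) (simp add: cylinder_def)
    then obtain y where y: "y \<in> U" "y \<in> cylinder X h (L \<inter> K) (\<lambda>i. h i x)"
      using x(1) unfolding in_closure_of by blast
    have "finite (g -` L)"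
      using L(1) g(1) by (rule finite_vimageI)
    then obtain n0 where n0: "\<And>m. m \<in> g -` L \<Longrightarrow> m < n0"
      by (meson finite_nat_set_iff_bounded)
    \<comment> \<open>From \<open>n0\<close> on, \<open>g n\<close> is outside \<open>L\<close>, so
      a change there does not leave \<open>V\<close>; two consecutive candidates cover both
      parities.\<close>
    obtain n where n: "n0 \<le> n" "even n = b"
      by (cases "even n0 = b") (auto intro: that[of n0] that[of "Suc n0"])
    have gL: "g n \<notin> L" using n0[of n] n(1) by auto
    let ?M = "L \<union> J y \<union> g ` {..n}"
    define e where "e i = (if i \<in> J y then h i y else if i = g n then \<not> h i x else h i x)" for i
    have "finite ?M" "?M \<subseteq> I" using L J[OF y(1)] g(2) by (simp, blast)
    then have "|X| \<le>o |cylinder X h ?M e|"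
      using ind by (simp add: independent_family_def)
    then obtain z where z: "z \<in> cylinder X h ?M e"
      using inf by (metis card_of_empty3 ex_in_conv finite.emptyI)
    have JK: "J y \<subseteq> K" using y(1) by (auto simp: K_def)
    have "z \<in> cylinder X h (J y) (\<lambda>i. h i y)"
      using z by (auto simp: cylinder_def e_def)
    then have zU: "z \<in> U" using J[OF y(1)] by blast
    have "z \<in> cylinder X h L (\<lambda>i. h i x)"
      using z y(2) JK gL by (auto simp: cylinder_def e_def split: if_splits)
    then have zV: "z \<in> V" using L(3) by blast
    have gJ: "g m \<notin> J y" for m using g(2) JK by blast
    have "h (g m) z = e (g m)" if "m \<le> n" for m
      using z that by (auto simp: cylinder_def)
    moreover have "e (g m) = (if m = n then \<not> h (g m) x else h (g m) x)" for m
      using gJ g(1) by (auto simp: e_def inj_eq)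
    ultimately have "k z = n"
      unfolding k_def by (intro Least_equality) (auto simp: not_less[symmetric])
    then show "\<exists>y. y \<noteq> x \<and> y \<in> A b \<and> y \<in> V"
      using zU zV n(2) x(2) by (auto simp: A_def)
  qed
  moreover have "A True \<subseteq> U" "A False \<subseteq> U" "A True \<inter> A False = {}"
    by (auto simp: A_def)
  ultimately show ?thesis by blast
qed

text \<open>Outside its interior a set has empty interior, so by submaximality that remainder is
  closed. Hence \<open>x\<close> accumulates at the interior.\<close>

lemma disjoint_tightness_of_split_open:
  assumes t1: "t1_space X" and sub: "submaximal_space X"
    and split: "\<And>U x. openin X U \<Longrightarrow> x \<in> X closure_of U \<Longrightarrow> x \<notin> U \<Longrightarrow>
      \<exists>A1 A2. A1 \<subseteq> U \<and> A2 \<subseteq> U \<and> A1 \<inter> A2 = {} \<and>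
        x \<in> X derived_set_of A1 \<inter> X derived_set_of A2"
  shows "disjoint_tightness X"
  unfolding disjoint_tightness_def
proof (intro allI impI, elim conjE)
  fix A x assume A: "A \<subseteq> topspace X" and x: "x \<in> X derived_set_of A"
  \<comment> \<open>Deleting \<open>x\<close> makes the complement of \<open>S\<close> a
    neighbourhood of \<open>x\<close> once \<open>S\<close> is known to be closed.\<close>
  define S where "S = A - X interior_of A - {x}"
  have "\<exists>y\<in>topspace X - S. y \<in> V" if V: "openin X V" "V \<noteq> {}" for V
  proof (rule ccontr)
    assume "\<not> ?thesis"
    then have VS: "V \<subseteq> S" using V openin_subset by blast
    then have "V \<subseteq> A" by (auto simp: S_def)
    then have "V \<subseteq> X interior_of A" using V(1) by (rule interior_of_maximal)
    then show False using VS V(2) by (auto simp: S_def)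
  qed
  then have "dense_in X (topspace X - S)"
    unfolding dense_in_def by (auto simp: in_closure_of) blast+
  then have open_S: "openin X (topspace X - S)"
    using sub by (simp add: submaximal_space_def)
  define U where "U = X interior_of A - {x}"
  have U: "openin X U"
    unfolding U_def using t1 x
    by (simp add: in_derived_set_of openin_diff t1_space_closedin_singleton)
  have "x \<in> X closure_of U"
    unfolding in_closure_of
  proof (intro conjI allI impI)
    show "x \<in> topspace X" using x by (simp add: in_derived_set_of)
    fix V assume V: "x \<in> V \<and> openin X V"
    then have "openin X (V \<inter> (topspace X - S))" "x \<in> V \<inter> (topspace X - S)"
      using open_S x by (auto simp: in_derived_set_of S_def)
    then obtain y where "y \<noteq> x" "y \<in> A" "y \<in> V \<inter> (topspace X - S)"
      using x unfolding in_derived_set_of by meson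
    then show "\<exists>y. y \<in> U \<and> y \<in> V"
      by (auto simp: U_def S_def)
  qed
  then obtain A1 A2 where "A1 \<subseteq> U" "A2 \<subseteq> U" "A1 \<inter> A2 = {}"
    "x \<in> X derived_set_of A1 \<inter> X derived_set_of A2"
    using split[OF U, of x] unfolding U_def by blast
  moreover have "U \<subseteq> A" unfolding U_def using interior_of_subset by fast
  ultimately show "\<exists>A1 A2. A1 \<subseteq> A \<and> A2 \<subseteq> A \<and> A1 \<inter> A2 = {} \<and>
      x \<in> X derived_set_of A1 \<inter> X derived_set_of A2"
    by (meson subset_trans)
qed

section \<open>Independent families of maximal size\<close>

text \<open>One point from the symmetric difference of each pair suffices.\<close>

lemma finite_set_distinguishing:
  assumes "finite J" "inj_on g J"
  shows "\<exists>F. finite F \<and> F \<subseteq> \<Union>(g ` J) \<and> inj_on (\<lambda>i. g i \<inter> F) J"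
proof -
  have "\<exists>p. p \<in> (g i - g j) \<union> (g j - g i)" if "i \<in> J" "j \<in> J" "i \<noteq> j" for i j
    using assms(2) that by (metis Diff_eq_empty_iff Un_empty equals0I inj_onD subset_antisym)
  then obtain p where p: "\<And>i j. i \<in> J \<Longrightarrow> j \<in> J \<Longrightarrow> i \<noteq> j \<Longrightarrow> p i j \<in> (g i - g j) \<union> (g j - g i)"
    by metis
  define F where "F = (\<lambda>(i, j). p i j) ` {(i, j) \<in> J \<times> J. i \<noteq> j}"
  have "finite {(i, j) \<in> J \<times> J. i \<noteq> j}"
    by (rule finite_subset[of _ "J \<times> J"]) (use assms in auto)
  then have "finite F" by (simp add: F_def)
  moreover have "F \<subseteq> \<Union>(g ` J)" using p by (fastforce simp: F_def)
  moreover have "inj_on (\<lambda>i. g i \<inter> F) J"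
  proof (rule inj_onI, rule ccontr)
    fix i j assume ij: "i \<in> J" "j \<in> J" "g i \<inter> F = g j \<inter> F" "i \<noteq> j"
    then have "p i j \<in> F" by (force simp: F_def)
    then show False using p[of i j] ij by blast
  qed
  ultimately show ?thesis by blast
qed

text \<open>Hausdorff's construction: the points are pairs \<open>(F, \<G>)\<close> of a finite set and a finite set of
  finite sets, and the set \<open>B\<close> is turned into the function \<open>B \<inter> F \<in> \<G>\<close>. The third factor of the
  product inflates every cylinder to full cardinality.\<close>

lemma exists_independent_family:
  assumes inf: "infinite X" and I: "|I| \<le>o |Pow X|"
  shows "\<exists>h. independent_family X I h"
proof -
  obtain g where g: "inj_on g I" "g ` I \<subseteq> Pow X"
    using I unfolding card_of_ordLeq[symmetric] by blast
  define Z where "Z = (Fpow X \<times> Fpow (Fpow X)) \<times> X"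
  have F1: "|Fpow X| =o |X|" using inf by (rule card_of_Fpow_infinite)
  then have "infinite (Fpow X)" using inf card_of_ordIso_finite by blast
  then have "|Fpow (Fpow X)| =o |X|"
    using F1 card_of_Fpow_infinite ordIso_transitive by blast
  then have "|Z| \<le>o |X|"
    unfolding Z_def using F1 inf
    by (intro card_of_Sigma_ordLeq_infinite ballI) (auto simp: ordIso_iff_ordLeq)
  moreover have "|X| \<le>o |Z|"
    unfolding Z_def by (rule card_of_Times2) (auto simp: Fpow_def)
  ultimately have "|X| =o |Z|" by (simp add: ordIso_iff_ordLeq)
  then obtain b where b: "bij_betw b X Z" using card_of_ordIso by blast
  define h where "h i y = (g i \<inter> fst (fst (b y)) \<in> snd (fst (b y)))" for i y
  have "|X| \<le>o |cylinder X h J e|" if J: "finite J" "J \<subseteq> I" for J e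
  proof -
    obtain F where F: "finite F" "F \<subseteq> \<Union>(g ` J)" "inj_on (\<lambda>i. g i \<inter> F) J"
      using finite_set_distinguishing[OF J(1)] inj_on_subset[OF g(1) J(2)] by blast
    \<comment> \<open>The traces of the indices that must get the value true; injectivity of the
      traces on \<open>J\<close> keeps the others out.\<close>
    define G where "G = (\<lambda>i. g i \<inter> F) ` {i \<in> J. e i}"
    have G: "g i \<inter> F \<in> G \<longleftrightarrow> e i" if "i \<in> J" for i
      using F(3) that by (auto simp: G_def inj_on_def)
    have "F \<subseteq> X" using F(2) g(2) J(2) by blast
    then have FG: "F \<in> Fpow X" "G \<in> Fpow (Fpow X)"
      using F(1) J(1) by (auto simp: Fpow_def G_def)
    have "(\<lambda>x. inv_into X b ((F, G), x)) ` X \<subseteq> cylinder X h J e"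
    proof
      fix y assume "y \<in> (\<lambda>x. inv_into X b ((F, G), x)) ` X"
      then obtain x where x: "x \<in> X" "y = inv_into X b ((F, G), x)" by blast
      have "((F, G), x) \<in> b ` X" using b FG x(1) by (simp add: bij_betw_def Z_def)
      then have "y \<in> X" "b y = ((F, G), x)"
        by (simp_all add: x(2) inv_into_into f_inv_into_f)
      then show "y \<in> cylinder X h J e"
        using G by (simp add: cylinder_def h_def)
    qed
    moreover have "inj_on (\<lambda>x. inv_into X b ((F, G), x)) X"
    proof (rule inj_onI)
      fix x x' assume x: "x \<in> X" "x' \<in> X"
        and eq: "inv_into X b ((F, G), x) = inv_into X b ((F, G), x')"
      have "((F, G), x) \<in> b ` X" "((F, G), x') \<in> b ` X"
        using b FG x by (simp_all add: bij_betw_def Z_def)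
      with eq have "((F, G), x) = ((F, G), x')" by (rule inv_into_injective)
      then show "x = x'" by simp
    qed
    ultimately show ?thesis unfolding card_of_ordLeq[symmetric] by blast
  qed
  then show ?thesis unfolding independent_family_def by blast
qed

section \<open>Closing a maximal family of sets\<close>

text \<open>For \<open>A \<in> \<A>\<close> and \<open>x \<notin> A\<close>, the coordinate \<open>(A, x)\<close> separates \<open>x\<close> from \<open>A\<close>, so that \<open>A\<close> becomes
  closed.\<close>

definition closing_family ::
    "('a set \<times> 'a \<Rightarrow> 'a \<Rightarrow> bool) \<Rightarrow> 'a set set \<Rightarrow> 'a set \<times> 'a \<Rightarrow> 'a \<Rightarrow> bool" where
  "closing_family f \<A> i y =
     (if fst i \<in> \<A> then y = snd i \<or> (y \<notin> fst i \<and> f i y) else f i y)"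

lemma closedin_closing_family:
  assumes "A \<in> \<A>" "A \<subseteq> X" "Pow X \<times> X \<subseteq> I"
  shows "closedin (cylinder_topology X I (closing_family f \<A>)) A"
  unfolding closedin_def openin_cylinder_topology topspace_cylinder_topology
proof (intro conjI ballI)
  fix x assume "x \<in> X - A"
  then show "\<exists>J. finite J \<and> J \<subseteq> I \<and>
      cylinder X (closing_family f \<A>) J (\<lambda>i. closing_family f \<A> i x) \<subseteq> X - A"
    using assms
    by (intro exI[of _ "{(A, x)}"]) (auto simp: cylinder_def closing_family_def)
qed (use assms in auto)

text \<open>A cylinder involves finitely many sets. Those in the union of a chain already lie in one
  member of it, which defines the same cylinder.\<close>

lemma exists_maximal_closing_family:
  assumes "independent_family X I f"
  shows "\<exists>\<A>. independent_family X I (closing_family f \<A>) \<and>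
           (\<forall>A. A \<notin> \<A> \<longrightarrow> \<not> independent_family X I (closing_family f (insert A \<A>)))"
proof -
  define P where "P = {\<A>. independent_family X I (closing_family f \<A>)}"
  have "{} \<in> P"
    using assms by (simp add: P_def independent_family_def cylinder_def closing_family_def)
  then have "P \<noteq> {}" by blast
  moreover have "\<Union>\<C> \<in> P" if \<C>: "\<C> \<noteq> {}" "subset.chain P \<C>" for \<C>
    unfolding P_def independent_family_def mem_Collect_eq
  proof (intro allI impI, elim conjE)
    fix J e assume J: "finite J" "J \<subseteq> I"
    have "finite (fst ` J \<inter> \<Union>\<C>)" using J(1) by simp
    then obtain C where C: "C \<in> \<C>" "fst ` J \<inter> \<Union>\<C> \<subseteq> C"
      using finite_subset_Union_chain[OF _ _ \<C>] by blast
    have "cylinder X (closing_family f (\<Union>\<C>)) J e = cylinder X (closing_family f C) J e"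
    proof -
      have "fst i \<in> C \<longleftrightarrow> fst i \<in> \<Union>\<C>" if "i \<in> J" for i
        using that C by blast
      then have "closing_family f C i = closing_family f (\<Union>\<C>) i" if "i \<in> J" for i
        using that by (simp add: closing_family_def fun_eq_iff)
      then show ?thesis by (simp add: cylinder_def)
    qed
    moreover have "C \<in> P" using C(1) \<C>(2) by (auto simp: subset.chain_def)
    ultimately show "|X| \<le>o |cylinder X (closing_family f (\<Union>\<C>)) J e|"
      using J by (simp add: P_def independent_family_def)
  qed
  ultimately obtain \<A> where "\<A> \<in> P" "\<forall>\<B>\<in>P. \<A> \<subseteq> \<B> \<longrightarrow> \<B> = \<A>"
    using subset_Zorn_nonempty by blast
  then show ?thesis
    unfolding P_def by (intro exI[of _ \<A>]) blast
qed

lemma cylinder_diff_small_of_maximal: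
  assumes inf: "infinite X"
    and "\<not> independent_family X I (closing_family f (insert A \<A>))"
  shows "\<exists>J e. finite J \<and> J \<subseteq> I \<and> |cylinder X (closing_family f \<A>) J e - A| <o |X|"
proof -
  obtain J e where J: "finite J" "J \<subseteq> I"
    and small: "|cylinder X (closing_family f (insert A \<A>)) J e| <o |X|"
    using assms(2) unfolding independent_family_def by (auto simp: not_ordLeq_iff_ordLess)
  have "cylinder X (closing_family f \<A>) J e - A \<subseteq>
      cylinder X (closing_family f (insert A \<A>)) J e \<union> snd ` J"
    by (auto simp: cylinder_def closing_family_def image_iff split: if_splits)
  moreover have "|cylinder X (closing_family f (insert A \<A>)) J e \<union> snd ` J| <o |X|"
    using inf small by (rule card_of_Un_ordLess_infinite) (use J(1) inf in \<open>simp add: finite_ordLess_infinite2\<close>)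
  ultimately show ?thesis
    using J by (meson card_of_mono1 ordLeq_ordLess_trans)
qed

section \<open>Construction of the submaximal space\<close>

theorem corollary5p10:
  fixes \<kappa> :: "'a rel"
  assumes "Card_order \<kappa>" and "infinite (Field \<kappa>)"
  shows "\<exists>X :: 'a topology.
           tychonoff_space X \<and> submaximal_space X \<and> irresolvable_space X \<and>
           |topspace X| =o \<kappa> \<and> dispersion_character X =o \<kappa> \<and>
           disjoint_tightness X"
proof -
  define X where "X = Field \<kappa>"
  \<comment> \<open>Each set gets its own coordinates. There are |Pow X| of them: few enough for an
    independent family, yet more than |X|.\<close>
  define I where "I = Pow X \<times> X"
  have inf: "infinite X" and X\<kappa>: "|X| =o \<kappa>"
    using assms by (simp_all add: X_def card_of_Field_ordIso)
  then have ne: "X \<noteq> {}" by auto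
  have infP: "infinite (Pow X)" using inf by simp
  have cI: "|I| =o |Pow X|"
    unfolding I_def using card_of_Times_infinite[OF infP ne] card_of_Pow ordLess_imp_ordLeq by blast
  then obtain f where "independent_family X I f"
    using exists_independent_family[OF inf] ordIso_imp_ordLeq by blast
  then obtain \<A> where ind: "independent_family X I (closing_family f \<A>)"
    and maxi: "\<And>A. A \<notin> \<A> \<Longrightarrow> \<not> independent_family X I (closing_family f (insert A \<A>))"
    using exists_maximal_closing_family by blast
  define h where "h = closing_family f \<A>"
  define T where "T = cylinder_topology X I h"
  have [simp]: "topspace T = X" by (simp add: T_def)
  have ind: "independent_family X I h" using ind by (simp add: h_def)
  have closed: "closedin T A" if "A \<in> \<A>" "A \<subseteq> X" for A
    unfolding T_def h_def using that by (rule closedin_closing_family) (simp add: I_def)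
  have cyl: "\<exists>J e. finite J \<and> J \<subseteq> I \<and> |cylinder X h J e - A| <o |X|" if "A \<notin> \<A>" for A
    unfolding h_def using cylinder_diff_small_of_maximal[OF inf maxi[OF that]] .
  have full: "\<not> |cylinder X h J e| <o |X|" if "finite J" "J \<subseteq> I" for J e
    using ind that unfolding independent_family_def using not_ordLess_ordLeq by blast
  \<comment> \<open>If \<open>S\<close> were not in \<open>\<A>\<close>, some cylinder would be
    small outside \<open>S\<close>, hence small altogether.\<close>
  have small_closed: "closedin T S" if S: "|S| <o |X|" "S \<subseteq> X" for S
  proof (rule closed)
    show "S \<in> \<A>"
    proof (rule ccontr)
      assume "S \<notin> \<A>"
      then obtain J e where J: "finite J" "J \<subseteq> I" "|cylinder X h J e - S| <o |X|"
        using cyl by blast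
      then have "|(cylinder X h J e - S) \<union> S| <o |X|"
        using S(1) inf card_of_Un_ordLess_infinite by blast
      moreover have "|cylinder X h J e| \<le>o |(cylinder X h J e - S) \<union> S|"
        by (rule card_of_mono1) blast
      ultimately show False using full[OF J(1,2)] ordLeq_ordLess_trans by blast
    qed
  qed (rule S(2))
  have t1: "t1_space T"
    unfolding t1_space_closedin_singleton
    using small_closed inf by (auto simp: finite_ordLess_infinite2)
  have tych: "tychonoff_space T"
    using t1 completely_regular_cylinder_topology by (simp add: tychonoff_space_def T_def)
  have sub: "submaximal_space T"
    unfolding submaximal_space_def
  proof (intro allI impI)
    fix D assume D: "dense_in T D"
    then have DX: "D \<subseteq> X" by (simp add: dense_in_def)
    \<comment> \<open>Otherwise some cylinder \<open>C\<close> meets \<open>D\<close> in a small,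
      hence closed, set, and the rest of \<open>C\<close> is a nonempty open set missing
      \<open>D\<close>.\<close>
    have "X - D \<in> \<A>"
    proof (rule ccontr)
      assume "X - D \<notin> \<A>"
      then obtain J e where J: "finite J" "J \<subseteq> I" "|cylinder X h J e - (X - D)| <o |X|"
        using cyl by blast
      define C where "C = cylinder X h J e"
      have "C - (X - D) = C \<inter> D" using DX by (auto simp: C_def cylinder_def)
      then have small: "|C \<inter> D| <o |X|" using J(3) by (simp add: C_def)
      then have "closedin T (C \<inter> D)" using small_closed DX by blast
      then have "openin T (C - C \<inter> D)"
        unfolding C_def T_def using openin_cylinder[OF J(1,2)] openin_diff by blast
      moreover have "C - C \<inter> D \<noteq> {}"
      proof
        assume "C - C \<inter> D = {}"
        then have "C \<inter> D = C" by blast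
        then show False using small full[OF J(1,2)] by (simp add: C_def)
      qed
      ultimately have "(C - C \<inter> D) \<inter> D \<noteq> {}"
        using D dense_intersects_open[of T D] unfolding dense_in_def by auto
      then show False by blast
    qed
    then have "closedin T (X - D)" using closed by simp
    then show "openin T D" using DX by (simp add: openin_closedin_eq)
  qed
  have disp: "dispersion_character T =o |X|"
    unfolding T_def using ind ne by (rule dispersion_character_cylinder_topology)
  have irr: "irresolvable_space T"
    unfolding irresolvable_space_def
  proof
    have "BNF_Cardinal_Arithmetic.ctwo \<le>o |X|"
      unfolding ctwo_def using inf by (simp add: finite_ordLess_infinite2 ordLess_imp_ordLeq)
    then show "BNF_Cardinal_Arithmetic.ctwo \<le>o dispersion_character T"
      using disp ordIso_symmetric ordLeq_ordIso_trans by blast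
    show "\<not> (\<exists>D E. dense_in T D \<and> dense_in T E \<and> D \<inter> E = {})"
    proof
      assume "\<exists>D E. dense_in T D \<and> dense_in T E \<and> D \<inter> E = {}"
      then obtain D E where DE: "dense_in T D" "dense_in T E" "D \<inter> E = {}" by blast
      have "openin T D" using sub DE(1) by (simp add: submaximal_space_def)
      moreover have "D \<noteq> {}" using DE(1) ne by (auto simp: dense_in_def)
      ultimately have "E \<inter> D \<noteq> {}"
        using DE(2) dense_intersects_open[of T E] unfolding dense_in_def by auto
      then show False using DE(3) by blast
    qed
  qed
  have "|X| <o |I|"
    using card_of_Pow cI ordIso_symmetric ordLess_ordIso_trans by blast
  then have "disjoint_tightness T"
    using cylinder_topology_split_open[OF ind inf]
    by (intro disjoint_tightness_of_split_open[OF t1 sub]) (simp add: T_def)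
  then show ?thesis
    using tych sub irr disp X\<kappa> by (intro exI[of _ T]) (auto intro: ordIso_transitive)
qed

end
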